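(* If $G$ is a finite group that is neither trivial nor of prime order, then $\mathrm{girth}(\mathcal P(G))\in \{3, 4, \infty\}$.
   Context: For a finite group $G$ that is neither trivial nor of prime order, the coprime graph of subgroups $\mathcal P(G)$ is the simple graph whose vertices are the proper subgroups of $G$ (here "proper" means different from $G$ and from the trivial subgroup), two distinct vertices $H,K$ being adjacent if and only if $|H|$ and $|K|$ are coprime. The girth of a graph is the length of its shortest cycle if one exists, and $\infty$ otherwise. *)

theory Defs
  imports
    "HOL-Algebra.Coset"
    "HOL-Computational_Algebra.Primes"
    "HOL-Library.Extended_Nat"
    "Graph_Theory.Pair_Digraph"
begin

text \<open>
  A simple graph is represented as a \<^locale>\<open>pair_graph\<close>: a finite, loop-free, symmetric digraph
  without parallel arcs, every edge $\{u,v\}$ being the pair of arcs $(u,v)$ and $(v,u)$.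
\<close>

definition coprime_subgroup_graph :: "('a, 'b) monoid_scheme \<Rightarrow> 'a set pair_pre_digraph" where
  "coprime_subgroup_graph G =
    (let V = {H. subgroup H G \<and> H \<noteq> carrier G \<and> H \<noteq> {\<one>\<^bsub>G\<^esub>}}
     in \<lparr> pverts = V,
          parcs = {(H, K). H \<in> V \<and> K \<in> V \<and> H \<noteq> K \<and> coprime (card H) (card K)} \<rparr>)"

text \<open>
  The bound \<open>3 \<le> length p\<close> excludes the closed walks \<open>u, v, u\<close> along a single edge, which
  \<^const>\<open>pre_digraph.cycle\<close> admits because it is a notion for directed graphs. The infimum of the
  empty set in \<^typ>\<open>enat\<close> is \<open>\<infinity>\<close>.
\<close>

definition girth :: "'v pair_pre_digraph \<Rightarrow> enat" where
  "girth D = Inf {enat (length p) | p. pre_digraph.cycle (with_proj D) p \<and> 3 \<le> length p}"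

lemma pair_graph_coprime_subgroup_graph:
  assumes "finite (carrier G)"
  shows "pair_graph (coprime_subgroup_graph G)"
proof -
  define V where "V = {H. subgroup H G \<and> H \<noteq> carrier G \<and> H \<noteq> {\<one>\<^bsub>G\<^esub>}}"
  have graph: "pverts (coprime_subgroup_graph G) = V"
    "parcs (coprime_subgroup_graph G) =
      {(H, K). H \<in> V \<and> K \<in> V \<and> H \<noteq> K \<and> coprime (card H) (card K)}"
    unfolding coprime_subgroup_graph_def V_def[symmetric] Let_def by simp_all
  have "V \<subseteq> Pow (carrier G)"
    unfolding V_def by (blast dest: subgroup.subset)
  then have V: "finite V"
    using assms finite_subset by blast
  have A: "finite (parcs (coprime_subgroup_graph G))"
    by (rule finite_subset[of _ "V \<times> V"]) (use V in \<open>auto simp: graph\<close>)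
  have sym: "sym (parcs (coprime_subgroup_graph G))"
    unfolding graph sym_def by (auto simp: coprime_commute)
  have arc: "fst e \<in> V" "snd e \<in> V" "fst e \<noteq> snd e"
    if "e \<in> parcs (coprime_subgroup_graph G)" for e
    using that unfolding graph by auto
  show ?thesis
  proof unfold_locales
    show "symmetric (with_proj (coprime_subgroup_graph G))"
      unfolding symmetric_def with_proj_simps by (rule sym)
  qed (use V A arc in \<open>simp_all only: graph(1) simp_thms\<close>)
qed

lemma girth_eq_infinity_iff:
  "girth D = \<infinity> \<longleftrightarrow> \<not> (\<exists>p. pre_digraph.cycle (with_proj D) p \<and> 3 \<le> length p)"
proof
  assume inf: "girth D = \<infinity>"
  show "\<not> (\<exists>p. pre_digraph.cycle (with_proj D) p \<and> 3 \<le> length p)"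
  proof
    assume "\<exists>p. pre_digraph.cycle (with_proj D) p \<and> 3 \<le> length p"
    then obtain p where "pre_digraph.cycle (with_proj D) p" "3 \<le> length p" by blast
    then have "girth D \<le> enat (length p)"
      unfolding girth_def by (intro Inf_lower) blast
    with inf show False by simp
  qed
next
  assume "\<not> (\<exists>p. pre_digraph.cycle (with_proj D) p \<and> 3 \<le> length p)"
  then have "{enat (length p) | p. pre_digraph.cycle (with_proj D) p \<and> 3 \<le> length p} = {}"
    by blast
  then show "girth D = \<infinity>"
    unfolding girth_def by (simp only: Inf_enat_def simp_thms if_True)
qed

end

theory Submission
  imports Defs "HOL-Algebra.Sylow"
begin

text \<open>
  A cycle of length at least four contains a path \<open>A, B, C, D\<close> on four distinct vertices. If \<open>D\<close> is
  adjacent to \<open>A\<close>, this path closes up to a cycle of length four. Otherwise some prime \<open>p\<close> divides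
  both \<open>|A|\<close> and \<open>|D|\<close>, hence neither \<open>|B|\<close> nor \<open>|C|\<close>; as \<open>|B|\<close> and \<open>|C|\<close> are coprime, \<open>|G|\<close> has
  three distinct prime divisors, and Cauchy's theorem gives a triangle.
\<close>

text \<open>For a closed walk \<open>p\<close> that is not empty, \<open>awalk_verts\<close> is the
  tail of the first arc followed by the heads of all arcs, so the distinctness in
  \<open>cycle\<close> is that of \<open>map snd p\<close>. In this form explicit arc lists can be
  checked by simplification.\<close>

lemma pair_cycle_iff:
  "pre_digraph.cycle (with_proj D) p \<longleftrightarrow>
    (\<exists>u. u \<in> pverts D \<and> set p \<subseteq> parcs D \<and> pre_digraph.cas (with_proj D) u p u
      \<and> distinct (map snd p) \<and> p \<noteq> [])"
  unfolding pre_digraph.cycle_def pre_digraph.awalk_def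
  by (auto simp: pre_digraph.awalk_verts_conv')

lemma girth_ge_3: "3 \<le> girth D"
proof -
  have "3 = enat 3" by (simp add: numeral_eq_enat)
  then show ?thesis unfolding girth_def by (auto intro!: Inf_greatest)
qed

lemma girth_le_length:
  assumes "pre_digraph.cycle (with_proj D) p" "3 \<le> length p"
  shows "girth D \<le> enat (length p)"
  unfolding girth_def by (rule Inf_lower) (use assms in blast)

lemma girth_le_3_if_triangle:
  assumes "u \<in> pverts D" "(u, v) \<in> parcs D" "(v, w) \<in> parcs D" "(w, u) \<in> parcs D"
    and "distinct [u, v, w]"
  shows "girth D \<le> 3"
proof -
  have "pre_digraph.cycle (with_proj D) [(u, v), (v, w), (w, u)]"
    using assms by (auto simp: pair_cycle_iff pre_digraph.cas.simps)
  from girth_le_length[OF this] show ?thesis by (simp add: numeral_eq_enat eval_nat_numeral)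
qed

lemma girth_le_4_if_square:
  assumes "u \<in> pverts D" "(u, v) \<in> parcs D" "(v, w) \<in> parcs D" "(w, x) \<in> parcs D" "(x, u) \<in> parcs D"
    and "distinct [u, v, w, x]"
  shows "girth D \<le> 4"
proof -
  have "pre_digraph.cycle (with_proj D) [(u, v), (v, w), (w, x), (x, u)]"
    using assms by (auto simp: pair_cycle_iff pre_digraph.cas.simps)
  from girth_le_length[OF this] show ?thesis by (simp add: numeral_eq_enat eval_nat_numeral)
qed

lemma cycle_contains_path:
  assumes "pre_digraph.cycle (with_proj D) p" "3 \<le> length p"
  obtains "length p = 3"
  | u v w x where "(u, v) \<in> parcs D" "(v, w) \<in> parcs D" "(w, x) \<in> parcs D" "distinct [u, v, w, x]"
proof (cases "length p = 3")
  case False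
  with assms(2) have "Suc (Suc (Suc (Suc 0))) \<le> length p" by simp
  then obtain a b c d es where p: "p = a # b # c # d # es"
    by (auto simp: Suc_le_length_iff)
  \<comment> \<open>The path runs through the heads of the first four arcs, since it is the heads
    that are known to be distinct; \<open>b\<close>, \<open>c\<close>, \<open>d\<close> are its
    arcs. This also covers a cycle of length exactly four, where \<open>es\<close> is empty.\<close>
  with assms(1) have "(snd a, snd b) \<in> parcs D" "(snd b, snd c) \<in> parcs D" "(snd c, snd d) \<in> parcs D"
    "distinct [snd a, snd b, snd c, snd d]"
    by (cases a; cases b; cases c; cases d; auto simp: pair_cycle_iff pre_digraph.cas.simps)+
  then show ?thesis by (rule that(2))
qed (rule that(1))

lemma (in group) cauchy:
  assumes "finite (carrier G)" "Factorial_Ring.prime p" "p dvd order G"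
  obtains H where "subgroup H G" "card H = p"
proof -
  \<comment> \<open>\<open>sylow_thm\<close> gives a subgroup of order \<open>p ^ a\<close> whenever
    \<open>p ^ a\<close> divides the order; here \<open>a\<close> is 1.\<close>
  from assms(3) obtain m where "order G = p ^ 1 * m" by (auto elim: dvdE)
  from sylow_thm[OF assms(2) is_group this assms(1)] show ?thesis using that by auto
qed

lemma pverts_coprime_subgroup_graph:
  "H \<in> pverts (coprime_subgroup_graph G) \<longleftrightarrow>
    subgroup H G \<and> H \<noteq> carrier G \<and> H \<noteq> {\<one>\<^bsub>G\<^esub>}"
  by (simp add: coprime_subgroup_graph_def Let_def)

lemma parcs_coprime_subgroup_graph:
  "(H, K) \<in> parcs (coprime_subgroup_graph G) \<longleftrightarrow>
    H \<in> pverts (coprime_subgroup_graph G) \<and> K \<in> pverts (coprime_subgroup_graph G) \<and>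
    H \<noteq> K \<and> coprime (card H) (card K)"
  by (simp add: coprime_subgroup_graph_def Let_def)

text \<open>A subgroup of order \<open>p\<close> from Cauchy's theorem is not all of
  \<open>G\<close>, as the order of \<open>G\<close> is not prime, and not trivial, as
  \<open>p\<close> is not 1.\<close>

lemma (in group) prime_order_vertex:
  assumes "finite (carrier G)" "\<not> Factorial_Ring.prime (order G)"
    and "Factorial_Ring.prime p" "p dvd order G"
  obtains H where "H \<in> pverts (coprime_subgroup_graph G)" "card H = p"
proof -
  obtain H where H: "subgroup H G" "card H = p"
    using cauchy[OF assms(1,3,4)] .
  have "H \<noteq> carrier G" using H(2) assms(2,3) by (auto simp: order_def)
  moreover have "H \<noteq> {\<one>}" using H(2) assms(3) by auto
  ultimately show ?thesis using H that by (simp add: pverts_coprime_subgroup_graph)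
qed

lemma (in group) girth_le_3_if_three_primes:
  assumes "finite (carrier G)" "\<not> Factorial_Ring.prime (order G)"
    and p: "Factorial_Ring.prime p" "p dvd order G"
    and q: "Factorial_Ring.prime q" "q dvd order G"
    and r: "Factorial_Ring.prime r" "r dvd order G"
    and ne: "p \<noteq> q" "q \<noteq> r" "r \<noteq> p"
  shows "girth (coprime_subgroup_graph G) \<le> 3"
proof -
  obtain P where P: "P \<in> pverts (coprime_subgroup_graph G)" "card P = p"
    using prime_order_vertex[OF assms(1,2) p] .
  obtain Q where Q: "Q \<in> pverts (coprime_subgroup_graph G)" "card Q = q"
    using prime_order_vertex[OF assms(1,2) q] .
  obtain R where R: "R \<in> pverts (coprime_subgroup_graph G)" "card R = r"
    using prime_order_vertex[OF assms(1,2) r] .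
  have "coprime p q" "coprime q r" "coprime r p"
    using p q r ne by (auto intro: primes_coprime)
  with P Q R ne show ?thesis
    by (intro girth_le_3_if_triangle[of P _ Q R]) (auto simp: parcs_coprime_subgroup_graph)
qed

text \<open>Together these facts give every vertex a prime divisor of its order that also divides
  the order of \<open>G\<close>.\<close>

lemma (in group) vertex_card:
  assumes "finite (carrier G)" "H \<in> pverts (coprime_subgroup_graph G)"
  shows "card H dvd order G" "card H \<noteq> 1"
proof -
  have H: "subgroup H G" "H \<noteq> {\<one>}"
    using assms(2) by (auto simp: pverts_coprime_subgroup_graph)
  then show "card H dvd order G"
    using lagrange[OF H(1)] by (metis dvd_triv_right)
  show "card H \<noteq> 1"
    using H subgroup.one_closed[OF H(1)] by (auto simp: card_1_singleton_iff)
qed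

lemma (in group) girth_le_4_if_path:
  assumes fin: "finite (carrier G)" and "\<not> Factorial_Ring.prime (order G)"
    and arcs: "(A, B) \<in> parcs (coprime_subgroup_graph G)" "(B, C) \<in> parcs (coprime_subgroup_graph G)"
      "(C, D) \<in> parcs (coprime_subgroup_graph G)"
    and "distinct [A, B, C, D]"
  shows "girth (coprime_subgroup_graph G) \<le> 4"
proof (cases "coprime (card A) (card D)")
  case True
  then have "(D, A) \<in> parcs (coprime_subgroup_graph G)"
    using assms by (auto simp: parcs_coprime_subgroup_graph coprime_commute)
  with arcs assms(6) show ?thesis
    by (intro girth_le_4_if_square[of A _ B C D]) (auto simp: parcs_coprime_subgroup_graph)
next
  case False
  have verts: "A \<in> pverts (coprime_subgroup_graph G)" "B \<in> pverts (coprime_subgroup_graph G)"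
      "C \<in> pverts (coprime_subgroup_graph G)"
    and coprime: "coprime (card A) (card B)" "coprime (card B) (card C)" "coprime (card C) (card D)"
    using arcs by (auto simp: parcs_coprime_subgroup_graph)
  from False have "gcd (card A) (card D) \<noteq> 1"
    by (simp add: coprime_iff_gcd_eq_1)
  then obtain p where p: "Factorial_Ring.prime p" "p dvd card A" "p dvd card D"
    using prime_factor_nat by (metis gcd_greatest_iff)
  obtain q where q: "Factorial_Ring.prime q" "q dvd card B"
    using prime_factor_nat vertex_card(2)[OF fin verts(2)] by blast
  obtain r where r: "Factorial_Ring.prime r" "r dvd card C"
    using prime_factor_nat vertex_card(2)[OF fin verts(3)] by blast
  \<comment> \<open>The three inequalities come from the arcs \<open>A B\<close>, \<open>B C\<close>
    and \<open>C D\<close> in turn; the last uses that \<open>p\<close> divides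
    \<open>card D\<close> as well as \<open>card A\<close>.\<close>
  have "p \<noteq> q" "q \<noteq> r" "r \<noteq> p"
    using p q r coprime by (metis coprime_common_divisor not_prime_unit)+
  moreover have "p dvd order G" "q dvd order G" "r dvd order G"
    using p q r verts vertex_card(1)[OF fin] dvd_trans by blast+
  ultimately have "girth (coprime_subgroup_graph G) \<le> 3"
    using girth_le_3_if_three_primes assms(1,2) p(1) q(1) r(1) by blast
  also have "(3 :: enat) \<le> 4" by simp
  finally show ?thesis .
qed

theorem theorem2p6:
  fixes G :: "('a, 'b) monoid_scheme"
  assumes "group G"
    and "finite (carrier G)"
    and "order G \<noteq> 1"
    and "\<not> Factorial_Ring.prime (order G)"
  shows "girth (coprime_subgroup_graph G) \<in> {3, 4, \<infinity>}"
proof (cases "girth (coprime_subgroup_graph G) = \<infinity>")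
  case False
  interpret group G by fact
  from False obtain p where p: "pre_digraph.cycle (with_proj (coprime_subgroup_graph G)) p" "3 \<le> length p"
    unfolding girth_eq_infinity_iff by blast
  have "girth (coprime_subgroup_graph G) \<le> 4"
    using p
  proof (cases rule: cycle_contains_path)
    case 1
    with girth_le_length[OF p] have "girth (coprime_subgroup_graph G) \<le> enat 3" by simp
    also have "enat 3 \<le> 4" by (simp add: numeral_eq_enat)
    finally show ?thesis .
  next
    case 2
    then show ?thesis using girth_le_4_if_path assms(2,4) by blast
  qed
  \<comment> \<open>The upper bound makes the girth a natural number, and only 3 and 4 lie between
    the bounds.\<close>
  with girth_ge_3[of "coprime_subgroup_graph G"] show ?thesis
    by (cases "girth (coprime_subgroup_graph G)") (auto simp: numeral_eq_enat)
qed simp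

end
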